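(* If there exists an OA$(s,2s,v)$, then there exists a $(t,s,v)$-AONT for all $t$ such that $1\le t\le s$.
   Context: An OA$(s,k,v)$ (orthogonal array) is a $v^s\times k$ array $A$ with entries from an alphabet $X$ of order $v$ such that, for every set $D$ of $s$ columns, the rows of $A$ restricted to the columns in $D$ contain every $s$-tuple of elements of $X$ exactly once. For a set $X$ with $|X|=v$, a function $\phi:X^s\to X^s$, $(x_1,\dots,x_s)\mapsto(y_1,\dots,y_s)$, is a $(t,s,v)$-AONT ($t$-all-or-nothing transform) if (1) $\phi$ is a bijection, and (2) whenever any $s-t$ of the output values $y_1,\dots,y_s$ are fixed (to arbitrary values), any $t$ of the input values are completely undetermined, i.e. for every $I\subseteq\{1,\dots,s\}$ with $|I|=t$, the tuple $(x_i)_{i\in I}$ takes on every value in $X^t$ (hence each exactly once) as the remaining $t$ outputs vary over $X^t$. *)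

theory Defs
  imports "HOL-Library.FuncSet"
begin

(* Rows, columns and coordinates are numbered from 0.  A tuple over X whose coordinates
   are indexed by a set I is an element of I \<rightarrow>\<^sub>E X, so that X^s is {..<s} \<rightarrow>\<^sub>E X. *)

(* A r c is the entry in row r and column c.  The rows form an indexed family, so equal rows
   at different positions are counted separately. *)
definition orthogonal_array ::
  "nat \<Rightarrow> nat \<Rightarrow> nat \<Rightarrow> 'a set \<Rightarrow> (nat \<Rightarrow> nat \<Rightarrow> 'a) \<Rightarrow> bool" where
  "orthogonal_array s k v X A \<longleftrightarrow>
     finite X \<and> card X = v \<and>
     (\<forall>r<v ^ s. \<forall>c<k. A r c \<in> X) \<and>
     (\<forall>D. D \<subseteq> {..<k} \<and> card D = s \<longrightarrow>
        (\<forall>x \<in> D \<rightarrow>\<^sub>E X. \<exists>!r. r < v ^ s \<and> restrict (A r) D = x))"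

(* J is the set of fixed output positions and y the fixed values there.  As \<phi> is a bijection,
   letting the remaining outputs vary amounts to running through the inputs x whose
   output agrees with y on J. *)
definition aont ::
  "nat \<Rightarrow> nat \<Rightarrow> nat \<Rightarrow> 'a set \<Rightarrow> ((nat \<Rightarrow> 'a) \<Rightarrow> (nat \<Rightarrow> 'a)) \<Rightarrow> bool" where
  "aont t s v X \<phi> \<longleftrightarrow>
     t \<le> s \<and> finite X \<and> card X = v \<and>
     bij_betw \<phi> ({..<s} \<rightarrow>\<^sub>E X) ({..<s} \<rightarrow>\<^sub>E X) \<and>
     (\<forall>J I. J \<subseteq> {..<s} \<and> card J = s - t \<and> I \<subseteq> {..<s} \<and> card I = t \<longrightarrow>
        (\<forall>y \<in> J \<rightarrow>\<^sub>E X.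
           (\<lambda>x. restrict x I) ` {x \<in> {..<s} \<rightarrow>\<^sub>E X. restrict (\<phi> x) J = y} = I \<rightarrow>\<^sub>E X))"

end

theory Submission
  imports Defs
begin

(* A row of the array is determined by its first s entries and also by its last s entries, so
   sending the former to the latter is a permutation of X^s.  Fixing s - t outputs and t inputs
   prescribes s of the 2s columns, and some row has these entries. *)

text \<open>The injection \<open>f\<close> identifies \<open>K\<close> with a set of
  \<open>s\<close> columns, on which every tuple occurs in exactly one row: existence gives
  surjectivity, uniqueness gives injectivity. The reindexing by \<open>f\<close> lets the last
  \<open>s\<close> columns be read as a tuple over \<open>{..<s}\<close>.\<close>

lemma orthogonal_array_select_bij:
  assumes A: "orthogonal_array s k v X A"
    and f: "inj_on f K" "f ` K \<subseteq> {..<k}" and K: "card K = s"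
  shows "bij_betw (\<lambda>r. \<lambda>i\<in>K. A r (f i)) {..<v ^ s} (K \<rightarrow>\<^sub>E X)"
proof -
  have "card (f ` K) = s"
    using f(1) K by (simp add: card_image)
  then have rows: "\<exists>!r. r < v ^ s \<and> restrict (A r) (f ` K) = x" if "x \<in> f ` K \<rightarrow>\<^sub>E X" for x
    using A f(2) that by (simp add: orthogonal_array_def)
  have entry: "A r (f i) \<in> X" if "r < v ^ s" "i \<in> K" for r i
    using A f(2) that by (simp add: orthogonal_array_def image_subset_iff)
  show ?thesis
  proof (rule bij_betw_imageI)
    show "inj_on (\<lambda>r. \<lambda>i\<in>K. A r (f i)) {..<v ^ s}"
    proof (rule inj_onI)
      fix r r' assume r: "r \<in> {..<v ^ s}" "r' \<in> {..<v ^ s}"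
        and eq: "(\<lambda>i\<in>K. A r (f i)) = (\<lambda>i\<in>K. A r' (f i))"
      have "A r (f i) = A r' (f i)" if "i \<in> K" for i
        using fun_cong[OF eq, of i] that by simp
      then have "restrict (A r) (f ` K) = restrict (A r') (f ` K)"
        by (auto simp: restrict_def fun_eq_iff)
      moreover have "restrict (A r) (f ` K) \<in> f ` K \<rightarrow>\<^sub>E X"
        using r(1) entry by auto
      ultimately show "r = r'"
        using rows[of "restrict (A r) (f ` K)"] r by auto
    qed
    show "(\<lambda>r. \<lambda>i\<in>K. A r (f i)) ` {..<v ^ s} = K \<rightarrow>\<^sub>E X"
    proof
      show "(\<lambda>r. \<lambda>i\<in>K. A r (f i)) ` {..<v ^ s} \<subseteq> K \<rightarrow>\<^sub>E X"
        using entry by auto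
      show "K \<rightarrow>\<^sub>E X \<subseteq> (\<lambda>r. \<lambda>i\<in>K. A r (f i)) ` {..<v ^ s}"
      proof
        fix x assume x: "x \<in> K \<rightarrow>\<^sub>E X"
        \<comment> \<open>The tuple \<open>x\<close> is carried over to the actual columns;
          injectivity of \<open>f\<close> makes \<open>inv_into K f\<close> undo it on
          \<open>K\<close>.\<close>
        then have "(\<lambda>c\<in>f ` K. x (inv_into K f c)) \<in> f ` K \<rightarrow>\<^sub>E X"
          by (auto simp: f(1))
        then obtain r where r: "r < v ^ s"
          and eq: "restrict (A r) (f ` K) = (\<lambda>c\<in>f ` K. x (inv_into K f c))"
          using rows by blast
        have "A r (f i) = x i" if "i \<in> K" for i
          using fun_cong[OF eq, of "f i"] that by (simp add: f(1))
        then have "(\<lambda>i\<in>K. A r (f i)) = x"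
          using x by (intro extensionalityI[where A = K]) (simp_all add: PiE_iff)
        then show "x \<in> (\<lambda>r. \<lambda>i\<in>K. A r (f i)) ` {..<v ^ s}"
          using r by blast
      qed
    qed
  qed
qed

lemma orthogonal_array_imp_aont:
  assumes A: "orthogonal_array s (2 * s) v X A" and t: "t \<le> s"
  shows "\<exists>\<phi>. aont t s v X \<phi>"
proof -
  define p where "p r = (\<lambda>i\<in>{..<s}. A r i)" for r
  define q where "q r = (\<lambda>i\<in>{..<s}. A r (s + i))" for r
  \<comment> \<open>Recover the row number from its left half, then read off its right half. The
    same \<open>\<phi>\<close> serves every \<open>t\<close>.\<close>
  define \<phi> where "\<phi> = q \<circ> inv_into {..<v ^ s} p"
  have p: "bij_betw p {..<v ^ s} ({..<s} \<rightarrow>\<^sub>E X)"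
    unfolding p_def by (rule orthogonal_array_select_bij[OF A, where f = "\<lambda>i. i"]) auto
  have q: "bij_betw q {..<v ^ s} ({..<s} \<rightarrow>\<^sub>E X)"
    unfolding q_def by (rule orthogonal_array_select_bij[OF A]) auto
  have \<phi>p: "\<phi> (p r) = q r" if "r < v ^ s" for r
    using p that by (simp add: \<phi>_def bij_betw_inv_into_left)
  have "bij_betw \<phi> ({..<s} \<rightarrow>\<^sub>E X) ({..<s} \<rightarrow>\<^sub>E X)"
    unfolding \<phi>_def by (rule bij_betw_trans[OF bij_betw_inv_into[OF p] q])
  moreover have "(\<lambda>x. restrict x I) ` {x \<in> {..<s} \<rightarrow>\<^sub>E X. restrict (\<phi> x) J = y} = I \<rightarrow>\<^sub>E X"
    if J: "J \<subseteq> {..<s}" "card J = s - t" and I: "I \<subseteq> {..<s}" "card I = t"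
      and y: "y \<in> J \<rightarrow>\<^sub>E X" for J I y
  proof
    show "(\<lambda>x. restrict x I) ` {x \<in> {..<s} \<rightarrow>\<^sub>E X. restrict (\<phi> x) J = y} \<subseteq> I \<rightarrow>\<^sub>E X"
      using I(1) by (auto simp: PiE_iff)
    show "I \<rightarrow>\<^sub>E X \<subseteq> (\<lambda>x. restrict x I) ` {x \<in> {..<s} \<rightarrow>\<^sub>E X. restrict (\<phi> x) J = y}"
    proof
      fix z assume z: "z \<in> I \<rightarrow>\<^sub>E X"
      \<comment> \<open>Output position \<open>j\<close> sits in column \<open>s + j\<close>, so
        \<open>D\<close> collects the columns of the prescribed inputs and outputs,
        \<open>t + (s - t) = s\<close> in total.\<close>
      define D where "D = I \<union> (+) s ` J"
      \<comment> \<open>The test \<open>c < s\<close> tells the two parts of \<open>D\<close> apart,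
        since \<open>I\<close> lies below \<open>s\<close>.\<close>
      define w where "w = (\<lambda>c\<in>D. if c < s then z c else y (c - s))"
      have "I \<inter> (+) s ` J = {}"
        using I(1) by auto
      then have "card D = s"
        unfolding D_def using finite_subset[OF I(1)] finite_subset[OF J(1)] I(2) J(2) t
        by (simp add: card_Un_disjoint card_image)
      then have "bij_betw (\<lambda>r. \<lambda>c\<in>D. A r c) {..<v ^ s} (D \<rightarrow>\<^sub>E X)"
        using I(1) J(1)
        by (intro orthogonal_array_select_bij[OF A, where f = "\<lambda>c. c"]) (auto simp: D_def)
      then have "(\<lambda>r. \<lambda>c\<in>D. A r c) ` {..<v ^ s} = D \<rightarrow>\<^sub>E X"
        by (rule bij_betw_imp_surj_on)
      moreover have "w \<in> D \<rightarrow>\<^sub>E X"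
        using y z I(1) J(1) by (auto simp: w_def D_def)
      ultimately have "w \<in> (\<lambda>r. \<lambda>c\<in>D. A r c) ` {..<v ^ s}"
        by (simp only:)
      then obtain r where r: "r < v ^ s" and eq: "restrict (A r) D = w"
        by (elim imageE) simp
      have inputs: "A r i = z i" if "i \<in> I" for i
        using fun_cong[OF eq, of i] that I(1) by (auto simp: w_def D_def)
      have outputs: "A r (s + j) = y j" if "j \<in> J" for j
        using fun_cong[OF eq, of "s + j"] that by (auto simp: w_def D_def)
      \<comment> \<open>The left half \<open>p r\<close> of the row found is the required input: it
        restricts to \<open>z\<close> on \<open>I\<close>, and its image \<open>q r\<close> has the
        entries \<open>A r (s + j) = y j\<close> for \<open>j\<close> in \<open>J\<close>.\<close>
      have "p r \<in> {..<s} \<rightarrow>\<^sub>E X"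
        using bij_betwE[OF p] r by blast
      moreover have "restrict (\<phi> (p r)) J = y"
        using J(1) y outputs
        by (intro extensionalityI[where A = J]) (auto simp: \<phi>p[OF r] q_def PiE_iff)
      moreover have "z = restrict (p r) I"
        using I(1) z inputs
        by (intro extensionalityI[where A = I]) (auto simp: p_def PiE_iff)
      ultimately show "z \<in> (\<lambda>x. restrict x I) ` {x \<in> {..<s} \<rightarrow>\<^sub>E X. restrict (\<phi> x) J = y}"
        by blast
    qed
  qed
  ultimately have "aont t s v X \<phi>"
    using A t by (simp add: aont_def orthogonal_array_def)
  then show ?thesis by (rule exI[of _ \<phi>])
qed

theorem corollary6p2:
  fixes s v :: nat
  assumes "\<exists>(X :: 'a set) A. orthogonal_array s (2 * s) v X A"
  shows "\<forall>t. 1 \<le> t \<and> t \<le> s \<longrightarrow> (\<exists>(X :: 'a set) \<phi>. aont t s v X \<phi>)"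
  using assms orthogonal_array_imp_aont by blast

end
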